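(* Let $\psi$ be a non-increasing continuous positive function such that $\psi(t)<1/t$ for all sufficiently large $t$. Then the complement $\mathbb{R}\smallsetminus D_2(\psi)$ is non-empty.
   Context: For a positive function $\psi$, $D_2(\psi)$ is the set of $\alpha\in\mathbb{R}$ such that for all sufficiently large $t>0$ there exist integers $(p,q)\neq(0,0)$ with $\left(\frac{\alpha q-p}{\psi(t)}\right)^2+\left(\frac{q}{t}\right)^2<\frac{2}{\sqrt3}$ (i.e. the lattice $\{(\alpha q-p,q)^T\}$ has a nonzero vector in $\operatorname{diag}(\psi(t),t)B_2(1/\sqrt{\Delta_2})$, with $B_2$ the open Euclidean ball and $\Delta_2=\sqrt3/2$). *)

theory Defs
  imports "HOL-Analysis.Analysis"
begin

definition D2 :: "(real \<Rightarrow> real) \<Rightarrow> real set" where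
  "D2 \<psi> = {\<alpha>. \<forall>\<^sub>F t in at_top. \<exists>p q :: int. (p, q) \<noteq> (0, 0) \<and>
     ((\<alpha> * of_int q - of_int p) / \<psi> t)\<^sup>2 + (of_int q / t)\<^sup>2 < 2 / sqrt 3}"

end

theory Submission
  imports Defs
begin

text \<open>
  With \<open>z = \<alpha> + i \<psi>(t)/t\<close> the form in question is \<open>|q z - p|\<^sup>2 / \<psi>(t)\<^sup>2\<close>. If \<open>z\<close> lies in the
  \<open>SL\<^sub>2(\<int>)\<close>-orbit of \<open>\<rho> = exp (i\<pi>/3)\<close>, the lattice is hexagonal and the form is at least
  \<open>(2/\<surd>3) / (t \<psi>(t)) > 2/\<surd>3\<close> off the origin. The orbit accumulates at every real number, and by
  continuity of \<open>\<psi>(t)/t\<close> every small height is attained at some large \<open>t\<close>. Hence the \<open>\<alpha>\<close> for which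
  the strict bound holds at some \<open>t \<ge> T\<close> are dense; they also form an open set, so Baire's theorem
  gives an \<open>\<alpha>\<close> that works for arbitrarily large \<open>t\<close>.
\<close>

section \<open>Hexagonal lattices and the orbit of \<rho>\<close>

lemma eisenstein_norm_ge_1:
  fixes x y :: int
  assumes "(x, y) \<noteq> (0, 0)"
  shows "x\<^sup>2 + x * y + y\<^sup>2 \<ge> 1"
proof -
  have eq: "4 * (x\<^sup>2 + x * y + y\<^sup>2) = (2 * x + y)\<^sup>2 + 3 * y\<^sup>2"
    by (simp add: power2_eq_square algebra_simps)
  have "(2 * x + y)\<^sup>2 + 3 * y\<^sup>2 > 0"
  proof (cases "y = 0")
    case True
    then show ?thesis using assms by simp
  next
    case False
    then show ?thesis by (simp add: add_nonneg_pos)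
  qed
  then have "0 < x\<^sup>2 + x * y + y\<^sup>2" by (simp flip: eq)
  then show ?thesis by simp
qed

text \<open>With z = (a \<rho> + b) / (c \<rho> + d) and N = |c \<rho> + d|^2, the left side is |q z
  - p|^2, where Im z = sqrt 3 / (2 N). Since q z - p = ((q a - p c) \<rho> + (q b - p d)) / (c
  \<rho> + d) and |x \<rho> + y|^2 = x^2 + x y + y^2, the right side follows.\<close>

lemma hexagonal_form_identity:
  fixes a b c d p q :: real
  defines "N \<equiv> c\<^sup>2 + c * d + d\<^sup>2"
  assumes det: "a * d - b * c = 1" and N: "N > 0"
  shows "((a * c + b * d + (a * d + b * c) / 2) / N * q - p)\<^sup>2 + (sqrt 3 / (2 * N))\<^sup>2 * q\<^sup>2
       = ((q * a - p * c)\<^sup>2 + (q * a - p * c) * (q * b - p * d) + (q * b - p * d)\<^sup>2) / N"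
proof -
  define A where "A = a * c + b * d + (a * d + b * c) / 2"
  define M where "M = a\<^sup>2 + a * b + b\<^sup>2"
  \<comment> \<open>Multiplicativity of the norm: \<open>A\<close> is the real part of (a \<rho> +
    b) times the conjugate of c \<rho> + d, and the imaginary part is (sqrt 3 / 2) (a d - b
    c).\<close>
  have "A\<^sup>2 + 3 / 4 * (a * d - b * c)\<^sup>2 = M * N"
    unfolding A_def M_def N_def by (simp add: field_simps power2_eq_square)
  then have A: "A\<^sup>2 + 3 / 4 = M * N" using det by simp
  have "(A / N * q - p)\<^sup>2 + (sqrt 3 / (2 * N))\<^sup>2 * q\<^sup>2
      = ((A\<^sup>2 + 3 / 4) * q\<^sup>2 - 2 * A * N * q * p + N\<^sup>2 * p\<^sup>2) / N\<^sup>2"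
    using N by (simp add: field_simps power2_eq_square)
  also have "\<dots> = (M * q\<^sup>2 - 2 * A * q * p + N * p\<^sup>2) / N"
    using N unfolding A by (simp add: field_simps power2_eq_square)
  also have "M * q\<^sup>2 - 2 * A * q * p + N * p\<^sup>2
      = (q * a - p * c)\<^sup>2 + (q * a - p * c) * (q * b - p * d) + (q * b - p * d)\<^sup>2"
    unfolding A_def M_def N_def by (simp add: field_simps power2_eq_square)
  finally show ?thesis by (simp add: A_def)
qed

text \<open>On the orbit of \<rho> the form is an Eisenstein norm of integers divided by N, hence at
  least 1 / N off the origin; the height y = sqrt 3 / (2 N) turns 1 / N into (2 / sqrt 3) y.\<close>

lemma hexagonal_points_accumulate:
  fixes x e :: real
  assumes "e > 0"
  obtains \<alpha> y :: real where "\<bar>\<alpha> - x\<bar> < e" "0 < y" "y < e"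
    "\<And>p q :: int. (p, q) \<noteq> (0, 0) \<Longrightarrow>
       (\<alpha> * of_int q - of_int p)\<^sup>2 + y\<^sup>2 * (of_int q)\<^sup>2 \<ge> 2 / sqrt 3 * y"
proof -
  \<comment> \<open>The estimates below are |\<alpha> - x| \<le> 3 / m and y \<le> 4 / m, whence 4 /
    e.\<close>
  obtain m :: nat where m: "real m > 4 / e" "m > 0"
    using reals_Archimedean2[of "4 / e"] assms
    by (metis divide_pos_pos gr0I less_trans of_nat_0 order.asym zero_less_numeral)
  define k where "k = \<lfloor>x * m\<rfloor>"
  \<comment> \<open>an explicit matrix in \<open>SL\<^sub>2(\<int>)\<close> taking \<open>\<infinity>\<close> to \<open>k/m + 1/m\<^sup>2\<close>\<close>
  define a b c d :: int where "a = 1 + k * m" and "b = - (k\<^sup>2)" and "c = (int m)\<^sup>2" and "d = 1 - k * m"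
  have det: "a * d - b * c = 1"
    by (simp add: a_def b_def c_def d_def power2_eq_square algebra_simps)
  have cm: "c \<ge> int m" using m by (simp add: c_def power2_eq_square)
  then have c: "c \<ge> 1" using m by linarith
  define N where "N = c\<^sup>2 + c * d + d\<^sup>2"
  have N1: "N \<ge> 1" using eisenstein_norm_ge_1[of c d] c by (simp add: N_def)
  \<comment> \<open>Each square serves once: 3 c^2 makes N grow with m, so the height tends to 0,
    and (c + 2 d)^2 controls the distance from \<alpha> to a / c.\<close>
  have eN: "4 * N = (c + 2 * d)\<^sup>2 + 3 * c\<^sup>2"
    by (simp add: N_def power2_eq_square algebra_simps)
  have "c * 1 \<le> c * c" using c by (intro mult_left_mono) auto
  then have Nm: "4 * N \<ge> 3 * int m"
    using eN c cm zero_le_power2[of "c + 2 * d"] unfolding power2_eq_square[of c] by linarith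
  have "(c + 2 * d)\<^sup>2 \<le> 4 * N" using eN by simp
  also have "\<dots> \<le> (2 * N)\<^sup>2" using N1 by (simp add: power2_eq_square)
  finally have cd: "\<bar>c + 2 * d\<bar> \<le> 2 * N"
    using N1 by (metis abs_le_square_iff abs_of_nonneg mult_nonneg_nonneg order_trans zero_le_numeral zero_le_one)
  define a' b' c' d' N' where "a' = real_of_int a" and "b' = real_of_int b" and "c' = real_of_int c"
    and "d' = real_of_int d" and "N' = real_of_int N"
  have det': "a' * d' - b' * c' = 1"
    using arg_cong[OF det, of real_of_int] by (simp add: a'_def b'_def c'_def d'_def)
  have N'_eq: "N' = c'\<^sup>2 + c' * d' + d'\<^sup>2" by (simp add: N'_def N_def c'_def d'_def)
  have N'1: "N' \<ge> 1" using N1 by (simp add: N'_def)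
  have c': "c' > 0" using c by (simp add: c'_def)
  have cd': "\<bar>c' + 2 * d'\<bar> \<le> 2 * N'"
    using cd unfolding c'_def d'_def N'_def by linarith
  define \<alpha> where "\<alpha> = (a' * c' + b' * d' + (a' * d' + b' * c') / 2) / N'"
  define y where "y = sqrt 3 / (2 * N')"
  \<comment> \<open>This is the real part of z - a / c = -1 / (c (c \<rho> + d)), which uses
    determinant 1.\<close>
  have "\<alpha> - a' / c' = - (c' + 2 * d') / (2 * N') / c'"
  proof -
    have bc: "b' * c' = a' * d' - 1" using det' by simp
    have "c' * (a' * c' + b' * d' + (a' * d' + b' * c') / 2) - a' * N'
        = d' * (b' * c') + c' * (b' * c') / 2 - a' * c' * d' / 2 - a' * d'\<^sup>2"
      by (simp add: N'_eq power2_eq_square field_simps)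
    also have "\<dots> = - (c' + 2 * d') / 2"
      unfolding bc by (simp add: power2_eq_square field_simps)
    finally show ?thesis using c' N'1
      by (simp add: \<alpha>_def divide_simps) (simp add: algebra_simps)
  qed
  then have "\<bar>\<alpha> - a' / c'\<bar> = \<bar>c' + 2 * d'\<bar> / (2 * N') / c'"
    using c' N'1 by (simp add: abs_divide)
  also have "\<dots> \<le> 1 / c'"
    using cd' c' N'1 by (intro divide_right_mono) auto
  also have "\<dots> \<le> 1 / m"
    using c cm m by (intro divide_left_mono) (auto simp: c'_def)
  finally have 1: "\<bar>\<alpha> - a' / c'\<bar> \<le> 1 / m" .
  have "a' / c' - x = (k - x * m) / m + 1 / (real m * real m)"
    using m by (simp add: a'_def c'_def a_def c_def field_simps power2_eq_square)
  moreover have "\<bar>k - x * m\<bar> \<le> 1" unfolding k_def by linarith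
  then have "\<bar>(k - x * m) / m\<bar> \<le> 1 / m"
    by (simp add: abs_divide divide_right_mono)
  moreover have "1 / (real m * real m) \<le> 1 / m" "1 / (real m * real m) \<ge> 0"
    using m by (auto simp: divide_simps)
  ultimately have 2: "\<bar>a' / c' - x\<bar> \<le> 2 / m" by linarith
  have em: "4 / real m < e" using m assms by (simp add: field_simps)
  have "\<bar>\<alpha> - x\<bar> \<le> 3 / m" using 1 2 by linarith
  also have "\<dots> \<le> 4 / m" by (simp add: divide_right_mono)
  finally have g1: "\<bar>\<alpha> - x\<bar> < e" using em by linarith
  have g2: "0 < y" using N'1 by (simp add: y_def)
  have "sqrt 3 \<le> 2" by (rule real_le_lsqrt) auto
  then have "y \<le> 1 / N'" using N'1 by (simp add: y_def field_simps)
  also have "\<dots> \<le> 4 / m"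
  proof -
    have "4 * N' \<ge> real m" using Nm unfolding N'_def by linarith
    then show ?thesis using N'1 m by (simp add: field_simps)
  qed
  finally have g3: "y < e" using em by linarith
  have g4: "(\<alpha> * of_int q - of_int p)\<^sup>2 + y\<^sup>2 * (of_int q)\<^sup>2 \<ge> 2 / sqrt 3 * y"
    if pq: "(p, q) \<noteq> (0, 0)" for p q :: int
  proof -
    define u v where "u = q * a - p * c" and "v = q * b - p * d"
    \<comment> \<open>Inverting the unimodular substitution: (p, q) is recovered from (u, v), so (u,
      v) cannot vanish.\<close>
    have "u * d - v * c = q * (a * d - b * c)" "u * b - v * a = p * (a * d - b * c)"
      by (simp_all add: u_def v_def algebra_simps)
    then have "(u, v) \<noteq> (0, 0)" using det pq by auto
    then have "u\<^sup>2 + u * v + v\<^sup>2 \<ge> 1" by (rule eisenstein_norm_ge_1)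
    then have uv: "1 \<le> (real_of_int u)\<^sup>2 + of_int u * of_int v + (of_int v)\<^sup>2"
      by (simp flip: of_int_power of_int_mult of_int_add)
    have "(\<alpha> * of_int q - of_int p)\<^sup>2 + y\<^sup>2 * (of_int q)\<^sup>2
       = ((real_of_int u)\<^sup>2 + of_int u * of_int v + (of_int v)\<^sup>2) / N'"
      using hexagonal_form_identity[OF det', of "of_int q" "of_int p"] N'1
      by (simp add: \<alpha>_def y_def N'_eq u_def v_def a'_def b'_def c'_def d'_def)
    also have "\<dots> \<ge> 1 / N'"
      using uv N'1 by (intro divide_right_mono) auto
    finally show ?thesis using N'1 by (simp add: y_def)
  qed
  show ?thesis using that[OF g1 g2 g3 g4] .
qed

section \<open>Stability of lower bounds under a change of \<alpha>\<close>

definition form_bounded_below :: "real \<Rightarrow> real \<Rightarrow> real \<Rightarrow> real \<Rightarrow> bool" where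
  "form_bounded_below s t C \<alpha> \<longleftrightarrow> (\<forall>p q :: int. (p, q) \<noteq> (0, 0) \<longrightarrow>
     C \<le> ((\<alpha> * of_int q - of_int p) / s)\<^sup>2 + (of_int q / t)\<^sup>2)"

text \<open>Changing \<open>\<alpha>\<close> by \<open>\<delta>\<close> moves a lattice vector by at most \<open>\<delta> t / s\<close> times its length.\<close>

lemma form_bounded_below_perturb:
  fixes s t C C' \<alpha> :: real
  assumes s: "s > 0" and t: "t > 0" and C: "0 < C'" "C' < C"
    and lower: "form_bounded_below s t C \<alpha>"
  obtains \<delta> where "\<delta> > 0" "\<And>\<beta>. \<bar>\<beta> - \<alpha>\<bar> < \<delta> \<Longrightarrow> form_bounded_below s t C' \<beta>"
proof -
  \<comment> \<open>Chosen so that (1 + \<eta>) sqrt C' = sqrt C. Passing from \<beta> to \<alpha>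
    lengthens a vector by a factor of at most 1 + \<eta>, so one \<delta> serves all (p, q).\<close>
  define \<eta> where "\<eta> = sqrt (C / C') - 1"
  define \<delta> where "\<delta> = \<eta> * s / t"
  have \<eta>: "\<eta> > 0" using C by (simp add: \<eta>_def)
  have "\<delta> > 0" using \<eta> s t by (simp add: \<delta>_def)
  moreover have "form_bounded_below s t C' \<beta>" if \<beta>: "\<bar>\<beta> - \<alpha>\<bar> < \<delta>" for \<beta>
    unfolding form_bounded_below_def
  proof (intro allI impI)
    fix p q :: int assume pq: "(p, q) \<noteq> (0, 0)"
    define X Y Z where "X = (\<alpha> * of_int q - of_int p) / s"
      and "Y = (\<beta> * of_int q - of_int p) / s" and "Z = of_int q / t"
    have XY: "X = Y + (\<alpha> - \<beta>) * of_int q / s" by (simp add: X_def Y_def field_simps diff_divide_distrib)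
    have "\<bar>(\<alpha> - \<beta>) * of_int q / s\<bar> = \<bar>\<beta> - \<alpha>\<bar> * \<bar>of_int q\<bar> / s"
      using s by (simp add: abs_mult abs_minus_commute)
    also have "\<dots> \<le> \<delta> * \<bar>of_int q\<bar> / s"
      using \<beta> s by (intro divide_right_mono mult_right_mono) auto
    also have "\<dots> = \<eta> * \<bar>Z\<bar>" using s t by (simp add: \<delta>_def Z_def)
    finally have diff: "\<bar>(\<alpha> - \<beta>) * of_int q / s\<bar> \<le> \<eta> * \<bar>Z\<bar>" .
    have "sqrt C \<le> sqrt (X\<^sup>2 + Z\<^sup>2)"
      using lower pq by (simp add: form_bounded_below_def X_def Z_def)
    also have "\<dots> \<le> sqrt (Y\<^sup>2 + Z\<^sup>2) + sqrt (((\<alpha> - \<beta>) * of_int q / s)\<^sup>2 + 0\<^sup>2)"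
      using real_sqrt_sum_squares_triangle_ineq[of Y "(\<alpha> - \<beta>) * of_int q / s" Z 0] XY by simp
    also have "\<dots> \<le> sqrt (Y\<^sup>2 + Z\<^sup>2) + \<eta> * \<bar>Z\<bar>" using diff by simp
    also have "\<dots> \<le> sqrt (Y\<^sup>2 + Z\<^sup>2) + \<eta> * sqrt (Y\<^sup>2 + Z\<^sup>2)"
      using \<eta> by (intro add_left_mono mult_left_mono) auto
    also have "\<dots> = sqrt (C / C') * sqrt (Y\<^sup>2 + Z\<^sup>2)" by (simp add: \<eta>_def algebra_simps)
    finally have "C \<le> C / C' * (Y\<^sup>2 + Z\<^sup>2)" by (simp flip: real_sqrt_mult)
    then have "C * C' \<le> C * (Y\<^sup>2 + Z\<^sup>2)" using C by (simp add: field_simps)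
    then have "C' \<le> Y\<^sup>2 + Z\<^sup>2" using C by (simp only: mult_le_cancel_left_pos)
    then show "C' \<le> ((\<beta> * of_int q - of_int p) / s)\<^sup>2 + (of_int q / t)\<^sup>2"
      by (simp add: Y_def Z_def)
  qed
  ultimately show ?thesis by (rule that)
qed

text \<open>A constant C' fits strictly between \<open>C0\<close> and C, and the bound C' survives
  near \<alpha>. This room is why the set asks for some C > \<open>C0\<close> instead of
  \<open>C0\<close> itself.\<close>

lemma open_form_bounded_below:
  fixes \<psi> :: "real \<Rightarrow> real" and A :: "real set"
  assumes "\<And>t. t \<in> A \<Longrightarrow> t > 0 \<and> \<psi> t > 0" and "C0 > 0"
  shows "open {\<alpha>. \<exists>t\<in>A. \<exists>C>C0. form_bounded_below (\<psi> t) t C \<alpha>}"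
  unfolding open_dist
proof
  fix \<alpha> assume "\<alpha> \<in> {\<alpha>. \<exists>t\<in>A. \<exists>C>C0. form_bounded_below (\<psi> t) t C \<alpha>}"
  then obtain t C where tC: "t \<in> A" "C > C0" "form_bounded_below (\<psi> t) t C \<alpha>" by blast
  obtain C' where C': "C0 < C'" "C' < C" using dense tC(2) by blast
  then have "0 < C'" using assms(2) by simp
  then obtain \<delta> where "\<delta> > 0" "\<And>\<beta>. \<bar>\<beta> - \<alpha>\<bar> < \<delta> \<Longrightarrow> form_bounded_below (\<psi> t) t C' \<beta>"
    using form_bounded_below_perturb[of "\<psi> t" t C' C \<alpha>] assms(1)[OF tC(1)] C' tC(3) by blast
  then show "\<exists>e>0. \<forall>\<beta>. dist \<beta> \<alpha> < e \<longrightarrow> \<beta> \<in> {\<alpha>. \<exists>t\<in>A. \<exists>C>C0. form_bounded_below (\<psi> t) t C \<alpha>}"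
    using tC(1) C'(1) by (auto simp: dist_real_def)
qed

section \<open>Density of the set with the strict bound\<close>

lemma small_height_attained:
  fixes \<psi> :: "real \<Rightarrow> real" and T y :: real
  assumes T: "T > 0" and pos: "\<And>t. t \<ge> T \<Longrightarrow> \<psi> t > 0"
    and anti: "antimono_on {T..} \<psi>" and cont: "continuous_on {T..} \<psi>"
    and y: "0 < y" "y < \<psi> T / T"
  obtains t where "t \<ge> T" "\<psi> t / t = y"
proof -
  \<comment> \<open>Monotonicity gives \<psi> S / S \<le> \<psi> T / S = y, while y < \<psi> T / T
    gives both T \<le> S and the opposite inequality at T; the intermediate value theorem applies on
    [T, S].\<close>
  define S where "S = \<psi> T / y"
  have TS: "T \<le> S" using y T by (simp add: S_def field_simps)
  then have "\<psi> S \<le> \<psi> T" using anti by (auto simp: monotone_on_def)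
  then have "\<psi> S / S \<le> \<psi> T / S" using TS T by (intro divide_right_mono) auto
  also have "\<dots> = y" using pos[of T] y by (simp add: S_def)
  finally have "\<psi> S / S \<le> y" .
  moreover have "continuous_on {T..S} (\<lambda>t. \<psi> t / t)"
    using T by (intro continuous_intros continuous_on_subset[OF cont]) auto
  ultimately show ?thesis
    using IVT2'[of "\<lambda>t. \<psi> t / t" S y T] y TS that by auto
qed

lemma dense_form_bounded_below:
  fixes \<psi> :: "real \<Rightarrow> real" and T :: real
  assumes T: "T > 0" and pos: "\<And>t. t \<ge> T \<Longrightarrow> \<psi> t > 0"
    and anti: "antimono_on {T..} \<psi>" and cont: "continuous_on {T..} \<psi>"
    and less: "\<And>t. t \<ge> T \<Longrightarrow> \<psi> t < 1 / t"
  shows "closure {\<alpha>. \<exists>t\<in>{T..}. \<exists>C>2 / sqrt 3. form_bounded_below (\<psi> t) t C \<alpha>} = UNIV"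
proof -
  have "\<exists>\<alpha>. (\<exists>t\<in>{T..}. \<exists>C>2 / sqrt 3. form_bounded_below (\<psi> t) t C \<alpha>) \<and> dist \<alpha> x < e"
    if e: "e > 0" for x e :: real
  proof -
    \<comment> \<open>The bound e keeps \<alpha> near x; the bound \<psi> T / T makes the height y
      equal to \<psi> t / t for some t \<ge> T.\<close>
    have "min e (\<psi> T / T) > 0" using e T pos by simp
    then obtain \<alpha> y where \<alpha>: "\<bar>\<alpha> - x\<bar> < e" "0 < y" "y < \<psi> T / T"
      and lower: "\<And>p q :: int. (p, q) \<noteq> (0, 0) \<Longrightarrow>
       (\<alpha> * of_int q - of_int p)\<^sup>2 + y\<^sup>2 * (of_int q)\<^sup>2 \<ge> 2 / sqrt 3 * y"
      using hexagonal_points_accumulate[of "min e (\<psi> T / T)" x] by (metis min_less_iff_conj)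
    obtain t where t: "t \<ge> T" "\<psi> t / t = y"
      using small_height_attained[OF T pos anti cont \<alpha>(2,3)] by blast
    have t0: "t > 0" and s0: "\<psi> t > 0" using t T pos by auto
    have "t * \<psi> t < 1" using less[OF t(1)] t0 by (simp add: field_simps)
    then have "1 < 1 / (t * \<psi> t)" using t0 s0 by simp
    then have C: "2 / sqrt 3 < 2 / sqrt 3 * (1 / (t * \<psi> t))"
      using mult_strict_left_mono[of 1 "1 / (t * \<psi> t)" "2 / sqrt 3"] by simp
    have "form_bounded_below (\<psi> t) t (2 / sqrt 3 * (1 / (t * \<psi> t))) \<alpha>"
      unfolding form_bounded_below_def
    proof (intro allI impI)
      fix p q :: int assume "(p, q) \<noteq> (0, 0)"
      \<comment> \<open>Since y = \<psi> t / t, dividing by the square of \<psi> t turns y^2 q^2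
        into (q / t)^2 and y into 1 / (t \<psi> t).\<close>
      then have "2 / sqrt 3 * y / (\<psi> t)\<^sup>2
          \<le> ((\<alpha> * of_int q - of_int p)\<^sup>2 + y\<^sup>2 * (of_int q)\<^sup>2) / (\<psi> t)\<^sup>2"
        using lower by (intro divide_right_mono) auto
      also have "2 / sqrt 3 * y / (\<psi> t)\<^sup>2 = 2 / sqrt 3 * (1 / (t * \<psi> t))"
        using t0 s0 by (simp flip: t(2) add: power2_eq_square)
      also have "((\<alpha> * of_int q - of_int p)\<^sup>2 + y\<^sup>2 * (of_int q)\<^sup>2) / (\<psi> t)\<^sup>2
          = ((\<alpha> * of_int q - of_int p) / \<psi> t)\<^sup>2 + (of_int q / t)\<^sup>2"
        using t0 s0 by (simp flip: t(2) add: power_divide add_divide_distrib)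
      finally show "2 / sqrt 3 * (1 / (t * \<psi> t))
          \<le> ((\<alpha> * of_int q - of_int p) / \<psi> t)\<^sup>2 + (of_int q / t)\<^sup>2" .
    qed
    then show ?thesis using C t(1) \<alpha>(1) by (auto simp: dist_real_def)
  qed
  then show ?thesis by (auto simp: closure_approachable)
qed

section \<open>The Baire category argument\<close>

theorem theorem1p5:
  fixes \<psi> :: "real \<Rightarrow> real" and t0 :: real
  assumes "t0 > 0"
    and "\<And>t. t \<ge> t0 \<Longrightarrow> \<psi> t > 0"
    and "antimono_on {t0..} \<psi>"
    and "continuous_on {t0..} \<psi>"
    and "\<forall>\<^sub>F t in at_top. \<psi> t < 1 / t"
  shows "- D2 \<psi> \<noteq> {}"
proof -
  obtain t1 where t1: "\<And>t. t \<ge> t1 \<Longrightarrow> \<psi> t < 1 / t"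
    using assms(5) by (auto simp: eventually_at_top_linorder)
  define T where "T n = max t0 t1 + real n" for n :: nat
  \<comment> \<open>The first two bounds make the hypotheses on \<psi> available beyond
    \<open>T n\<close>; the third, with \<open>t0 > 0\<close>, gives \<open>T n \<ge> n\<close>, so
    membership in every \<open>U n\<close> yields failures at arbitrarily large t.\<close>
  have Tge: "t0 \<le> T n" "t1 \<le> T n" "real n \<le> T n - t0" for n by (auto simp: T_def)
  have Tpos: "T n > 0" for n using assms(1) Tge(1)[of n] by linarith
  define U where "U n = {\<alpha>. \<exists>t\<in>{T n..}. \<exists>C>2 / sqrt 3. form_bounded_below (\<psi> t) t C \<alpha>}" for n
  have "open (U n)" for n
    unfolding U_def using Tpos[of n] Tge(1)[of n] assms(2)
    by (intro open_form_bounded_below) auto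
  moreover have "closure (U n) = UNIV" for n
    unfolding U_def
  proof (rule dense_form_bounded_below)
    have sub: "{T n..} \<subseteq> {t0..}" using Tge(1)[of n] by auto
    show "antimono_on {T n..} \<psi>" using monotone_on_subset[OF assms(3) sub] .
    show "continuous_on {T n..} \<psi>" using continuous_on_subset[OF assms(4) sub] .
  qed (use Tpos[of n] Tge(1,2)[of n] assms(2) t1 in auto)
  ultimately have "UNIV \<subseteq> closure (\<Inter>(range U))"
    by (intro Baire) auto
  then have "\<Inter>(range U) \<noteq> {}" by (metis UNIV_not_empty closure_empty subset_empty)
  then obtain \<alpha> where \<alpha>: "\<And>n. \<alpha> \<in> U n" by blast
  have "\<alpha> \<notin> D2 \<psi>"
  proof
    assume "\<alpha> \<in> D2 \<psi>"
    then obtain S where S: "\<And>t. t \<ge> S \<Longrightarrow> \<exists>p q :: int. (p, q) \<noteq> (0, 0) \<and>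
        ((\<alpha> * of_int q - of_int p) / \<psi> t)\<^sup>2 + (of_int q / t)\<^sup>2 < 2 / sqrt 3"
      unfolding D2_def eventually_at_top_linorder by blast
    obtain n :: nat where n: "real n \<ge> S" using real_arch_simple by blast
    obtain t C where t: "t \<ge> T n" "C > 2 / sqrt 3" "form_bounded_below (\<psi> t) t C \<alpha>"
      using \<alpha>[of n] by (auto simp: U_def)
    have "t \<ge> S" using n t(1) Tge(3)[of n] assms(1) by linarith
    from S[OF this] obtain p q :: int where pq: "(p, q) \<noteq> (0, 0)"
      "((\<alpha> * of_int q - of_int p) / \<psi> t)\<^sup>2 + (of_int q / t)\<^sup>2 < 2 / sqrt 3" by blast
    with t(2,3) show False
      unfolding form_bounded_below_def by (meson le_less_trans less_asym)
  qed
  then show ?thesis by blast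
qed

end
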